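(* Let $0<q<1$, $\lambda\in\mathbb{R}$, and let $x$ be a nonzero complex number such that neither $-x$ nor $-q^\lambda x$ is of the form $q^m$ with $m\in\mathbb{Z}$. Let $$w(x;q)=\frac{1}{(-x;q)_\infty(-qx^{-1};q)_{\infty}},$$ and define the fractional Stieltjes-Wigert function $S_\lambda(x;q)$ by $$w(x;q)\,S_\lambda(x;q)=\frac{q^{\lambda}(1-q)^{\lambda}}{(q;q)_\lambda}\,D_q^{\lambda}\left[w(q^\lambda x;q)\right],$$ where $D_q^\lambda$ is applied to the function $x\mapsto w(q^\lambda x;q)$. Then $$S_{\lambda}(x;q)=\frac{(-x;q)_{\lambda}\,(-qx^{-1};q)_{-\lambda}}{(q;q)_{\lambda}}\left(\frac{q}{x}\right)^{\lambda}{}_1\phi_1\!\left(\begin{matrix}q^{-\lambda}\\ 0\end{matrix}\,\middle|\,q;-xq^{\lambda+1}\right).$$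
   Context: Notation: $(s;q)_n=\prod_{j=0}^{n-1}(1-sq^j)$, $(s;q)_\infty=\prod_{j=0}^\infty(1-sq^j)$, and for real $\mu$, $(s;q)_\mu=\frac{(s;q)_\infty}{(sq^\mu;q)_\infty}$, with $\frac1{(q;q)_\lambda}=\frac{(q^{\lambda+1};q)_\infty}{(q;q)_\infty}$. Here $x^\lambda$ is the principal value and $(q/x)^\lambda$ means $q^\lambda/x^\lambda$. The basic hypergeometric series is $${}_1\phi_1\!\left(\begin{matrix}a_1\\ b_1\end{matrix}\,\middle|\,q;z\right)=\sum_{n=0}^\infty\frac{(a_1;q)_n}{(b_1;q)_n}(-1)^nq^{\binom n2}\frac{z^n}{(q;q)_n},\qquad (0;q)_n=1.$$ The fractional $q$-derivative of order $\lambda$ is $$(D_q^{\lambda}f)(x)=\frac{1}{x^{\lambda}(1-q)^{\lambda}}\sum_{n=0}^{\infty}\frac{(q^{-\lambda};q)_n}{(q;q)_n}q^n f(q^n x).$$ *)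

theory Defs
  imports "HOL-Analysis.Analysis"
begin

definition qpoch :: "complex \<Rightarrow> real \<Rightarrow> nat \<Rightarrow> complex" where
  "qpoch s q n = (\<Prod>j<n. 1 - s * of_real q ^ j)"

definition qpoch_inf :: "complex \<Rightarrow> real \<Rightarrow> complex" where
  "qpoch_inf s q = (\<Prod>j. 1 - s * of_real q ^ j)"

definition qpoch_real :: "complex \<Rightarrow> real \<Rightarrow> real \<Rightarrow> complex" where
  "qpoch_real s q \<mu> = qpoch_inf s q / qpoch_inf (s * of_real (q powr \<mu>)) q"

(* If \<mu> is a negative integer, then qpoch_real q q \<mu> is a division by zero, but the
   reciprocal 1 / (q;q)_\<mu> still has its conventional value, which is 0 in that case. *)
lemma inverse_qpoch_real_self:
  assumes "0 < q"
  shows "1 / qpoch_real (of_real q) q \<mu> =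
           qpoch_inf (of_real (q powr (\<mu> + 1))) q / qpoch_inf (of_real q) q"
  using assms by (simp add: qpoch_real_def powr_add mult.commute)

definition phi_1_1 :: "complex \<Rightarrow> complex \<Rightarrow> real \<Rightarrow> complex \<Rightarrow> complex" where
  "phi_1_1 a b q z =
     (\<Sum>n. qpoch a q n / qpoch b q n * (-1) ^ n * of_real q ^ (n choose 2)
            * z ^ n / qpoch (of_real q) q n)"

definition q_frac_deriv :: "real \<Rightarrow> real \<Rightarrow> (complex \<Rightarrow> complex) \<Rightarrow> complex \<Rightarrow> complex" where
  "q_frac_deriv q lam f x =
     1 / (x powr of_real lam * of_real ((1 - q) powr lam)) *
     (\<Sum>n. qpoch (of_real (q powr (- lam))) q n / qpoch (of_real q) q n
            * of_real q ^ n * f (of_real q ^ n * x))"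

definition sw_weight :: "real \<Rightarrow> complex \<Rightarrow> complex" where
  "sw_weight q x = 1 / (qpoch_inf (- x) q * qpoch_inf (- of_real q / x) q)"

(* The defining relation solved for S; see frac_stieltjes_wigert_eq below. *)
definition frac_stieltjes_wigert :: "real \<Rightarrow> real \<Rightarrow> complex \<Rightarrow> complex" where
  "frac_stieltjes_wigert q lam x =
     (of_real (q powr lam * (1 - q) powr lam) / qpoch_real (of_real q) q lam
       * q_frac_deriv q lam (\<lambda>y. sw_weight q (of_real (q powr lam) * y)) x)
     / sw_weight q x"

lemma qpoch_inf_nonzero:
  assumes "0 < q" "q < 1" "\<And>j. s * of_real q ^ j \<noteq> 1"
  shows "qpoch_inf s q \<noteq> 0"
proof -
  have "summable (\<lambda>j. norm s * q ^ j)"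
    using assms(1,2) by (intro summable_mult summable_geometric) auto
  then have "summable (\<lambda>j. norm ((1 - s * of_real q ^ j) - 1))"
    using assms(1) by (simp add: norm_mult norm_power)
  then have "convergent_prod (\<lambda>j. 1 - s * of_real q ^ j)"
    by (intro abs_convergent_prod_imp_convergent_prod summable_imp_abs_convergent_prod)
  then show ?thesis
    unfolding qpoch_inf_def using assms(3) by (intro prodinf_nonzero) auto
qed

lemma sw_weight_nonzero:
  assumes q: "0 < q" "q < 1" and x: "x \<noteq> 0" "\<And>m::int. - x \<noteq> of_real (q powi m)"
  shows "sw_weight q x \<noteq> 0"
proof -
  have "- x * of_real q ^ j \<noteq> 1" for j
  proof
    assume "- x * of_real q ^ j = 1"
    then have "- x = of_real (q powi (- int j))"
      using q by (simp add: power_int_minus field_simps)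
    with x(2) show False by blast
  qed
  moreover have "- of_real q / x * of_real q ^ j \<noteq> 1" for j
  proof
    assume "- of_real q / x * of_real q ^ j = 1"
    then have "- x = of_real q ^ Suc j"
      using x(1) by (auto simp: field_simps)
    also have "\<dots> = of_real (q powi int (Suc j))"
      by (simp only: power_int_of_nat of_real_power)
    finally show False using x(2) by blast
  qed
  ultimately show ?thesis
    using q by (simp add: sw_weight_def qpoch_inf_nonzero)
qed

lemma frac_stieltjes_wigert_eq:
  assumes "0 < q" "q < 1" "x \<noteq> 0" "\<And>m::int. - x \<noteq> of_real (q powi m)"
  shows "sw_weight q x * frac_stieltjes_wigert q lam x =
           of_real (q powr lam * (1 - q) powr lam) / qpoch_real (of_real q) q lam
           * q_frac_deriv q lam (\<lambda>y. sw_weight q (of_real (q powr lam) * y)) x"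
  using sw_weight_nonzero[OF assms] by (simp add: frac_stieltjes_wigert_def)

end

(* With w = sw_weight q, the recurrence w (q y) = y w(y) gives w (q^n y) = q^(n choose 2) y^n w(y). At
   y = q^lam x this turns the series of the fractional derivative into w(y) times the 1-phi-1 series,
   and the quotient w(y) / w(x) is the product of the two shifted factorials in front. *)
theory Submission
  imports Defs
begin

text \<open>Split off the factor j = 0 in the partial products and pass to the limit on both sides.
  Absolute convergence makes this valid also when some factor vanishes.\<close>

lemma qpoch_inf_rec:
  assumes "0 < q" "q < 1"
  shows "qpoch_inf s q = (1 - s) * qpoch_inf (s * of_real q) q"
proof -
  have "summable (\<lambda>j. norm s * q ^ j)"
    using assms by (intro summable_mult summable_geometric) auto
  then have "summable (\<lambda>j. norm ((1 - s * of_real q ^ j) - 1))"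
    using assms(1) by (simp add: norm_mult norm_power)
  then have conv: "convergent_prod (\<lambda>j. 1 - s * of_real q ^ j)"
    by (intro abs_convergent_prod_imp_convergent_prod summable_imp_abs_convergent_prod)
  then have "(\<lambda>n. \<Prod>j\<le>n. 1 - s * of_real q ^ j) \<longlonglongrightarrow> qpoch_inf s q"
    unfolding qpoch_inf_def by (rule convergent_prod_LIMSEQ)
  \<comment> \<open>The bound \<open>Suc n\<close> leaves exactly the factors j \<le> n of the
    shifted product once j = 0 is removed.\<close>
  then have "(\<lambda>n. \<Prod>j\<le>Suc n. 1 - s * of_real q ^ j) \<longlonglongrightarrow> qpoch_inf s q"
    by (rule LIMSEQ_Suc)
  moreover have "convergent_prod (\<lambda>j. 1 - s * of_real q ^ Suc j)"
    using convergent_prod_ignore_initial_segment[OF conv, of 1] by simp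
  then have "(\<lambda>n. \<Prod>j\<le>n. 1 - s * of_real q * of_real q ^ j)
      \<longlonglongrightarrow> qpoch_inf (s * of_real q) q"
    unfolding qpoch_inf_def by (intro convergent_prod_LIMSEQ) (simp add: mult.assoc)
  then have "(\<lambda>n. (1 - s) * (\<Prod>j\<le>n. 1 - s * of_real q * of_real q ^ j))
      \<longlonglongrightarrow> (1 - s) * qpoch_inf (s * of_real q) q"
    by (rule tendsto_mult_left)
  then have "(\<lambda>n. \<Prod>j\<le>Suc n. 1 - s * of_real q ^ j)
      \<longlonglongrightarrow> (1 - s) * qpoch_inf (s * of_real q) q"
    by (simp only: prod.atMost_Suc_shift power_0 mult_1_right power_Suc mult.assoc)
  ultimately show ?thesis
    by (rule LIMSEQ_unique)
qed

text \<open>Passing from y to q y removes the factor 1 + y from the first product of the denominator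
  and adds 1 + 1/y to the second; the quotient of the two is y. Cancelling 1 + y is where y must
  differ from -1.\<close>

lemma sw_weight_mult_q:
  assumes q: "0 < q" "q < 1" and y: "y \<noteq> 0" "y \<noteq> - 1"
  shows "sw_weight q (of_real q * y) = y * sw_weight q y"
proof -
  have nz: "1 + y \<noteq> 0"
    using y(2) by (metis add_eq_0_iff)
  have "qpoch_inf (- y) q = (1 + y) * qpoch_inf (- (of_real q * y)) q"
    using qpoch_inf_rec[OF q, of "- y"] by (simp add: mult.commute)
  moreover have "qpoch_inf (- of_real q / (of_real q * y)) q
      = (1 + y) / y * qpoch_inf (- of_real q / y) q"
    using qpoch_inf_rec[OF q, of "- of_real q / (of_real q * y)"] q y(1)
    by (simp add: field_simps)
  ultimately show ?thesis
    using y(1) nz by (simp add: sw_weight_def)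
qed

text \<open>Iterating the recurrence collects the factors q^k y for k < n. The excluded powers of q
  guarantee that no q^k y equals -1.\<close>

lemma sw_weight_mult_q_power:
  assumes q: "0 < q" "q < 1" and y: "y \<noteq> 0" "\<And>m::int. - y \<noteq> of_real (q powi m)"
  shows "sw_weight q (of_real q ^ n * y) = of_real q ^ (n choose 2) * y ^ n * sw_weight q y"
proof (induction n)
  case 0
  then show ?case by (simp add: numeral_2_eq_2)
next
  case (Suc n)
  have "of_real q ^ n * y \<noteq> - 1"
  proof
    assume "of_real q ^ n * y = - 1"
    then have "- y = of_real (q powi (- int n))"
      using q by (simp add: power_int_minus field_simps add_eq_0_iff)
    with y(2) show False by blast
  qed
  then have "sw_weight q (of_real q * (of_real q ^ n * y))
      = of_real q ^ n * y * sw_weight q (of_real q ^ n * y)"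
    using q y(1) by (intro sw_weight_mult_q) auto
  then have "sw_weight q (of_real q ^ Suc n * y)
      = of_real q ^ n * y * (of_real q ^ (n choose 2) * y ^ n * sw_weight q y)"
    by (simp only: power_Suc mult.assoc Suc.IH)
  \<comment> \<open>Pascal's rule: n + (n choose 2) is \<open>Suc n choose 2\<close>.\<close>
  then show ?case
    by (simp add: numeral_2_eq_2 power_add mult_ac)
qed

text \<open>The quadratic exponent of q puts a factor q^n into the ratio of consecutive terms, which
  therefore tends to 0 for every z.\<close>

lemma summable_phi_1_1_0:
  fixes a z :: complex
  assumes q: "0 < q" "q < 1"
  shows "summable (\<lambda>n. qpoch a q n / qpoch 0 q n * (-1) ^ n * of_real q ^ (n choose 2)
           * z ^ n / qpoch (of_real q) q n)"
    (is "summable ?t")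
proof -
  let ?r = "\<lambda>n. (1 - a * of_real q ^ n) / (1 - of_real q * of_real q ^ n)
    * of_real q ^ n * - z"
  have step: "?t (Suc n) = ?r n * ?t n" for n
    by (simp add: qpoch_def numeral_2_eq_2 power_add mult_ac)
  have "norm (of_real q :: complex) < 1"
    using q by simp
  then have "?r \<longlonglongrightarrow> (1 - a * 0) / (1 - of_real q * 0) * 0 * - z"
    by (intro tendsto_intros LIMSEQ_power_zero) auto
  then have "eventually (\<lambda>n. norm (?r n) < 1 / 2) sequentially"
    by (intro order_tendstoD(2)[OF tendsto_norm_zero]) simp_all
  then obtain N where N: "\<And>n. n \<ge> N \<Longrightarrow> norm (?r n) < 1 / 2"
    by (auto simp: eventually_sequentially)
  show ?thesis
  proof (rule summable_ratio_test)
    show "norm (?t (Suc n)) \<le> 1 / 2 * norm (?t n)" if "N \<le> n" for n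
      unfolding step norm_mult[of "?r n"]
      using N[OF that] by (intro mult_right_mono) auto
  qed simp
qed

text \<open>The weight at q^n y contributes y^n and q^(n choose 2); together with the q^n of the
  fractional derivative this is the power (q y)^n, and -q y is the argument of the series.\<close>

lemma q_frac_deriv_sw_weight:
  fixes q lam :: real and x :: complex
  defines "y \<equiv> of_real (q powr lam) * x"
  assumes q: "0 < q" "q < 1" and x: "x \<noteq> 0"
    and y: "\<And>m::int. - y \<noteq> of_real (q powi m)"
  shows "q_frac_deriv q lam (\<lambda>z. sw_weight q (of_real (q powr lam) * z)) x =
           sw_weight q y / (x powr of_real lam * of_real ((1 - q) powr lam))
           * phi_1_1 (of_real (q powr (- lam))) 0 q (- x * of_real (q powr (lam + 1)))"
proof -
  define a :: complex where "a = of_real (q powr (- lam))"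
  let ?t = "\<lambda>n. qpoch a q n / qpoch 0 q n * (-1) ^ n * of_real q ^ (n choose 2)
    * (- x * of_real (q powr (lam + 1))) ^ n / qpoch (of_real q) q n"
  have y0: "y \<noteq> 0"
    using q x by (simp add: y_def)
  have z: "- x * of_real (q powr (lam + 1)) = - (of_real q * y)"
    using q by (simp add: y_def powr_add)
  have summand: "qpoch a q n / qpoch (of_real q) q n * of_real q ^ n
      * sw_weight q (of_real (q powr lam) * (of_real q ^ n * x)) = sw_weight q y * ?t n" for n
  proof -
    have arg: "of_real (q powr lam) * (of_real q ^ n * x) = of_real q ^ n * y"
      by (simp add: y_def mult_ac)
    \<comment> \<open>The sign in the definition of the series cancels the sign of its
      argument.\<close>
    have "(-1) ^ n * (- (of_real q * y)) ^ n = of_real q ^ n * y ^ n"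
      by (simp flip: power_mult_distrib)
    then have "?t n = qpoch a q n / qpoch (of_real q) q n * of_real q ^ (n choose 2)
        * (of_real q ^ n * y ^ n)"
      by (simp only: z) (simp add: qpoch_def[of 0] mult_ac)
    then show ?thesis
      by (simp only: arg sw_weight_mult_q_power[OF q y0 y]) (simp add: mult_ac)
  qed
  \<comment> \<open>Convergence is what allows the constant \<open>sw_weight q y\<close> to leave
    the infinite sum.\<close>
  have "summable ?t"
    using q by (rule summable_phi_1_1_0)
  then have "(\<Sum>n. sw_weight q y * ?t n) = sw_weight q y * suminf ?t"
    by (rule suminf_mult)
  then show ?thesis
    unfolding q_frac_deriv_def phi_1_1_def a_def[symmetric] summand by simp
qed

theorem proposition16:
  fixes q lam :: real and x :: complex
  assumes "0 < q" and "q < 1"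
    and "x \<noteq> 0"
    and "\<forall>m::int. - x \<noteq> of_real (q powi m)"
    and "\<forall>m::int. - (of_real (q powr lam) * x) \<noteq> of_real (q powi m)"
  shows "frac_stieltjes_wigert q lam x =
           qpoch_real (- x) q lam * qpoch_real (- of_real q / x) q (- lam)
             / qpoch_real (of_real q) q lam
           * (of_real (q powr lam) / x powr of_real lam)
           * phi_1_1 (of_real (q powr (- lam))) 0 q (- x * of_real (q powr (lam + 1)))"
proof -
  define y where "y = of_real (q powr lam) * x"
  have deriv: "q_frac_deriv q lam (\<lambda>z. sw_weight q (of_real (q powr lam) * z)) x =
      sw_weight q y / (x powr of_real lam * of_real ((1 - q) powr lam))
      * phi_1_1 (of_real (q powr (- lam))) 0 q (- x * of_real (q powr (lam + 1)))"
    using assms unfolding y_def by (intro q_frac_deriv_sw_weight) auto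
  \<comment> \<open>These are the shifted bases in the denominators of the two
    \<open>qpoch_real\<close> factors, so those denominators form the weight at y.\<close>
  have "- x * of_real (q powr lam) = - y"
    and "- of_real q / x * of_real (q powr (- lam)) = - of_real q / y"
    using assms(1) by (simp_all add: y_def powr_minus field_simps)
  then have weight: "sw_weight q y / sw_weight q x =
      qpoch_real (- x) q lam * qpoch_real (- of_real q / x) q (- lam)"
    by (simp add: qpoch_real_def sw_weight_def)
  have "frac_stieltjes_wigert q lam x =
      of_real (q powr lam * (1 - q) powr lam) / qpoch_real (of_real q) q lam
      * (1 / (x powr of_real lam * of_real ((1 - q) powr lam)))
      * phi_1_1 (of_real (q powr (- lam))) 0 q (- x * of_real (q powr (lam + 1)))
      * (sw_weight q y / sw_weight q x)"
    by (simp add: frac_stieltjes_wigert_def deriv)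
  \<comment> \<open>The nonzero power of 1 - q cancels. The reciprocal of
    \<open>qpoch_real (of_real q) q lam\<close> stands on both sides, so a negative integer
    \<open>lam\<close>, where it is 0, needs no separate case.\<close>
  then show ?thesis
    using assms(2) unfolding weight by (simp add: mult_ac)
qed

end
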